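(* For every positive integer $n$, the following identities (of polynomials in $x$) hold: (i) $$U_n(x)+\sum_{k=1}^{n}\frac{(-U_1(x))^k}{k}\left(\sum_{i=0}^{\left[\frac{n-k}{2}\right]}\binom{n-i}{k-1}\binom{k+i-1}{k-1}(n-k-2i+1)\,U_{n-k-2i}(x)\right)=\cos\frac{\pi n}{2};$$ (ii) $$\sum_{k=0}^{n}\left(\sum_{i=0}^{\left[\frac{n-k}{2}\right]}(-1)^{n-(k+2i)}\frac{k+1}{i+k+1}\binom{n-i}{k+i}\binom{n-k-i-1}{i}U_1(x)^{n-(k+2i)}\right)U_k(x)=\cos\frac{\pi n}{2};$$ (iii) $$(n+1)P_n^{\left(\frac12,\frac12\right)}(x)+\sum_{k=1}^{n}\frac{(-x)^k(n+k+1)!}{k!\,2^k\,n!}P_{n-k}^{\left(k+\frac12,k+\frac12\right)}(x)=\binom{n+\frac12}{n}\cos\frac{\pi n}{2}.$$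
   Context: The Chebyshev polynomials of the second kind $U_n(x)$ are defined by $\frac{1}{1-2xt+t^2}=\sum_{n\ge 0}U_n(x)t^n$. $P_n^{(\alpha,\beta)}(x)$ denotes the Jacobi polynomial of degree $n$, with the standard normalization $P_n^{(\alpha,\beta)}(1)=\binom{n+\alpha}{n}$. Notation: $[a]$ in summation limits is the integer part; $\binom{a}{m}=a(a-1)\cdots(a-m+1)/m!$ for integers $m\ge 0$ and arbitrary $a$ (in particular $\binom{-1}{0}=1$). *)

theory Defs
  imports "HOL-Analysis.Analysis" "HOL-Computational_Algebra.Computational_Algebra"
begin

text \<open>
  The generating function \<open>1 / (1 - 2 x t + t\<^sup>2)\<close> is read as a formal power series in \<open>t\<close> over
  the polynomial ring \<open>\<real>[x]\<close>: \<open>fps_X\<close> is \<open>t\<close> and \<open>[:0, 2:]\<close> is \<open>2 x\<close>. Since \<open>inverse\<close> is not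
  available on \<open>\<real>[x]\<close>, the series is inverted with \<open>fps_right_inverse\<close>, whose second
  argument is the inverse of the constant term.
\<close>

definition cheb_U :: "nat \<Rightarrow> real poly" where
  "cheb_U n =
     fps_nth (fps_right_inverse (1 - fps_const [:0, 2:] * fps_X + fps_X ^ 2) 1) n"

lemma cheb_U_generating_function:
  "(1 - fps_const [:0, 2:] * fps_X + fps_X ^ 2) * Abs_fps cheb_U = 1"
proof -
  let ?f = "1 - fps_const [:0, 2:] * fps_X + fps_X ^ 2 :: real poly fps"
  have "Abs_fps cheb_U = fps_right_inverse ?f 1"
    by (intro fps_ext) (simp add: cheb_U_def)
  moreover have "?f * fps_right_inverse ?f 1 = 1"
    by (rule fps_right_inverse) (simp add: fps_X_power_nth)
  ultimately show ?thesis by simp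
qed

text \<open>
  Jacobi polynomials, via the classical representation
  \<open>(\<alpha> + 1)\<^sub>n / n! * \<^sub>2F\<^sub>1 (-n, n + \<alpha> + \<beta> + 1; \<alpha> + 1; (1 - x) / 2)\<close>, written as a finite sum in powers of
  \<open>(x - 1) / 2\<close> that makes sense for all real parameters.
\<close>

definition jacobi_poly :: "nat \<Rightarrow> real \<Rightarrow> real \<Rightarrow> real poly" where
  "jacobi_poly n \<alpha> \<beta> =
     (\<Sum>k\<le>n. smult (((real n + \<alpha>) gchoose (n - k)) * pochhammer (real n + \<alpha> + \<beta> + 1) k / fact k)
               ([:- 1/2, 1/2:] ^ k))"

lemma poly_jacobi_poly_1: "poly (jacobi_poly n \<alpha> \<beta>) 1 = (real n + \<alpha>) gchoose n"
proof -
  have "poly (jacobi_poly n \<alpha> \<beta>) 1 =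
      (\<Sum>k\<le>n. if k = 0 then (real n + \<alpha>) gchoose n else 0)"
    unfolding jacobi_poly_def poly_sum by (intro sum.cong) auto
  then show ?thesis by simp
qed

end

theory Submission
  imports Defs
begin

text \<open>
  All three right-hand sides are multiples of \<open>U\<^sub>n(0) = cos (\<pi> n / 2)\<close>.

  Identities (i) and (iii) are the Taylor expansion \<open>p(0) = (\<Sum>k. (-x)\<^sup>k / k! * p\<^sup>(\<^sup>k\<^sup>)(x))\<close> of
  \<open>p = U\<^sub>n\<close>. For (i) the higher derivatives are expanded in the \<open>U\<^sub>m\<close>, by iterating
  \<open>U'\<^sub>m\<^sub>+\<^sub>1 - U'\<^sub>m\<^sub>-\<^sub>1 = 2 (m + 1) U\<^sub>m\<close>. For (iii), \<open>U\<^sub>n\<close> is a multiple of the Jacobi polynomial with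
  parameters \<open>1/2\<close>, and differentiating a Jacobi polynomial raises both parameters by one.

  For (ii), write \<open>y = 2 x = U\<^sub>1\<close> and let \<open>c(n, k)\<close> be the coefficient of \<open>U\<^sub>k\<close>. These coefficients satisfy
  \<open>c(n, k+1) + c(n, k-1) = c(n-1, k) + c(n+1, k) + y c(n, k)\<close>. Summing against \<open>U\<^sub>k\<close> and using
  \<open>U\<^sub>k\<^sub>+\<^sub>1 + U\<^sub>k\<^sub>-\<^sub>1 = y U\<^sub>k\<close>, the left-hand sides \<open>a\<^sub>n\<close> of (ii) satisfy \<open>a\<^sub>n\<^sub>+\<^sub>1 = - a\<^sub>n\<^sub>-\<^sub>1\<close>.
\<close>

section \<open>Basic facts on Chebyshev polynomials: recurrence, value at zero, degree\<close>

lemma smult_sum_right: "smult c (sum f A) = (\<Sum>i\<in>A. smult c (f i))"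
  by (induction A rule: infinite_finite_induct) (simp_all add: smult_add_right)

lemma cheb_U_0: "cheb_U 0 = 1"
  using arg_cong[OF cheb_U_generating_function, of "\<lambda>f. fps_nth f 0"]
  by simp

text \<open>Used to read the three-term recurrence off the generating function. The case split keeps
  the truncated \<open>n - 1\<close> from contributing \<open>fps_nth F 0\<close> when
  \<open>n = 0\<close>.\<close>

lemma fps_nth_generating_denominator:
  fixes F :: "'a::comm_ring_1 fps"
  shows "fps_nth ((1 - fps_const c * fps_X + fps_X ^ 2) * F) (Suc n) =
     fps_nth F (Suc n) - c * fps_nth F n + (if n = 0 then 0 else fps_nth F (n - 1))"
proof -
  have "(1 - fps_const c * fps_X + fps_X ^ 2) * F
     = F - fps_const c * (fps_X * F) + fps_X * (fps_X * F)"
    by (simp add: algebra_simps power2_eq_square)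
  then show ?thesis by (simp add: fps_mult_left_const_nth)
qed

lemma cheb_U_1: "cheb_U (Suc 0) = [:0, 2:]"
proof -
  have "cheb_U (Suc 0) - [:0, 2:] * cheb_U 0 = 0"
    using arg_cong[OF cheb_U_generating_function, of "\<lambda>f. fps_nth f (Suc 0)"]
    by (simp only: fps_nth_generating_denominator) simp
  then show ?thesis by (simp add: cheb_U_0)
qed

lemma cheb_U_rec: "cheb_U (Suc (Suc n)) = [:0, 2:] * cheb_U (Suc n) - cheb_U n"
proof -
  have "cheb_U (Suc (Suc n)) - [:0, 2:] * cheb_U (Suc n) + cheb_U n = 0"
    using arg_cong[OF cheb_U_generating_function, of "\<lambda>f. fps_nth f (Suc (Suc n))"]
    by (simp only: fps_nth_generating_denominator) simp
  then show ?thesis by (simp add: eq_diff_eq eq_neg_iff_add_eq_0 algebra_simps)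
qed

lemma cos_half_pi_Suc_Suc: "cos (pi * real (Suc (Suc n)) / 2) = - cos (pi * real n / 2)"
proof -
  have "pi * real (Suc (Suc n)) / 2 = pi * real n / 2 + pi" by (simp add: field_simps)
  then show ?thesis by (simp only: cos_periodic_pi)
qed

lemma poly_cheb_U_zero: "poly (cheb_U n) 0 = cos (pi * real n / 2)"
proof (induction n rule: induct_nat_012)
  case (ge2 n)
  then show ?case
    by (simp only: cheb_U_rec cos_half_pi_Suc_Suc) simp
qed (simp_all add: cheb_U_0 cheb_U_1)

lemma degree_cheb_U_le: "degree (cheb_U n) \<le> n"
proof (induction n rule: induct_nat_012)
  case (ge2 n)
  have "degree ([:0, 2:] * cheb_U (Suc n)) \<le> Suc (Suc n)"
    using degree_mult_le[of "[:0, 2:]" "cheb_U (Suc n)"] ge2 by simp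
  then show ?case
    unfolding cheb_U_rec using ge2 by (intro degree_diff_le) auto
qed (simp_all add: cheb_U_0 cheb_U_1)

section \<open>Derivative recurrence for Chebyshev polynomials and Taylor expansion at zero\<close>

text \<open>Differentiating the three-term recurrence shows that the differences on the left obey
  the same recurrence with an extra term \<open>2 * (U_(n+3) - U_(n+1))\<close>. After the induction
  hypotheses are inserted, the coefficient of \<open>U_(n+1)\<close> is
  \<open>-2 + 2(n+3) - 2(n+2) = 0\<close>.\<close>

lemma pderiv_cheb_U_rec:
  "pderiv (cheb_U (Suc (Suc n))) - pderiv (cheb_U n) = smult (2 * real (n + 2)) (cheb_U (Suc n))"
proof (induction n rule: induct_nat_012)
  case 0
  show ?case
    by (simp add: cheb_U_rec cheb_U_0 cheb_U_1 pderiv_pCons one_pCons)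
next
  case 1
  show ?case
    by (simp add: cheb_U_rec cheb_U_0 cheb_U_1 pderiv_pCons one_pCons)
next
  case (ge2 n)
  let ?D = "\<lambda>j. pderiv (cheb_U j)" and ?y = "[:0, 2::real:]"
  have D: "?D (Suc (Suc j)) = smult 2 (cheb_U (Suc j)) + ?y * ?D (Suc j) - ?D j" for j
    by (simp add: cheb_U_rec pderiv_diff pderiv_mult pderiv_pCons pderiv_smult algebra_simps)
  have "?D (Suc (Suc (Suc (Suc n)))) - ?D (Suc (Suc n)) =
      smult 2 (cheb_U (Suc (Suc (Suc n))) - cheb_U (Suc n))
      + ?y * (?D (Suc (Suc (Suc n))) - ?D (Suc n)) - (?D (Suc (Suc n)) - ?D n)"
    by (simp only: D[of "Suc (Suc n)"] D[of n] smult_diff_right) (simp only: algebra_simps)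
  also have "\<dots> = smult 2 (cheb_U (Suc (Suc (Suc n))) - cheb_U (Suc n))
      + smult (2 * real (n + 3)) (?y * cheb_U (Suc (Suc n))) - smult (2 * real (n + 2)) (cheb_U (Suc n))"
    by (simp only: ge2) (simp add: algebra_simps)
  also have "?y * cheb_U (Suc (Suc n)) = cheb_U (Suc (Suc (Suc n))) + cheb_U (Suc n)"
    by (simp add: cheb_U_rec[of "Suc n"])
  also have "smult 2 (cheb_U (Suc (Suc (Suc n))) - cheb_U (Suc n))
      + smult (2 * real (n + 3)) (cheb_U (Suc (Suc (Suc n))) + cheb_U (Suc n))
      - smult (2 * real (n + 2)) (cheb_U (Suc n))
      = smult (2 * real (Suc (Suc n) + 2)) (cheb_U (Suc (Suc (Suc n))))"
    by (rule poly_eqI) (simp add: algebra_simps)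
  finally show ?case .
qed

lemma higher_pderiv_cheb_U_rec:
  "(pderiv ^^ Suc k) (cheb_U (Suc (Suc n))) =
     (pderiv ^^ Suc k) (cheb_U n) + smult (2 * real (n + 2)) ((pderiv ^^ k) (cheb_U (Suc n)))"
proof -
  have "pderiv (cheb_U (Suc (Suc n))) = pderiv (cheb_U n) + smult (2 * real (n + 2)) (cheb_U (Suc n))"
    using pderiv_cheb_U_rec[of n] by (simp add: algebra_simps)
  then show ?thesis
    by (simp only: funpow_Suc_right o_apply higher_pderiv_add higher_pderiv_smult)
qed

text \<open>The derivative of the partial Taylor sum telescopes to its last term, which vanishes.\<close>

lemma Taylor_at_zero:
  fixes p :: "real poly"
  assumes "degree p \<le> n"
  shows "(\<Sum>k\<le>n. smult (1 / fact k) ((- [:0, 1:]) ^ k * (pderiv ^^ k) p)) = [:poly p 0:]"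
proof -
  let ?x = "[:0, 1::real:]"
  let ?S = "\<lambda>n. \<Sum>k\<le>n. smult (1 / fact k) ((- ?x) ^ k * (pderiv ^^ k) p)"
  have "pderiv (?S n) = smult (1 / fact n) ((- ?x) ^ n * (pderiv ^^ Suc n) p)" for n
  proof (induction n)
    case (Suc n)
    let ?q = "- ?x" and ?A = "(pderiv ^^ Suc n) p"
    have "pderiv (?q ^ Suc n) = - smult (real (Suc n)) (?q ^ n)"
      by (simp only: pderiv_power_Suc) (simp add: pderiv_pCons pderiv_minus flip: smult_minus_left)
    then have "smult (1 / fact (Suc n)) (pderiv (?q ^ Suc n * ?A)) =
        smult (1 / fact (Suc n)) (?q ^ Suc n * pderiv ?A)
        - smult (1 / fact (Suc n) * real (Suc n)) (?q ^ n * ?A)"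
      by (simp only: pderiv_mult smult_diff_right smult_smult[symmetric])
         (simp only: mult_minus_right mult_smult_right smult_add_right smult_minus_right mult.commute[of ?A]
           mult_minus_left mult_smult_left diff_conv_add_uminus)
    moreover have "1 / fact (Suc n) * real (Suc n) = (1 / fact n :: real)"
      by (simp add: divide_simps del: of_nat_Suc)
    ultimately show ?case
      using Suc by (simp only: sum.atMost_Suc pderiv_add pderiv_smult) simp
  qed simp
  moreover have "(pderiv ^^ Suc n) p = 0"
    by (rule poly_eqI) (use assms in \<open>simp add: coeff_higher_pderiv coeff_eq_0 del: funpow.simps\<close>)
  ultimately have "pderiv (?S n) = 0" by simp
  then obtain c where c: "?S n = [:c:]"
    using pderiv_iszero by blast
  have "poly (?S n) 0 = (\<Sum>k\<le>n. if k = 0 then poly p 0 else 0)"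
    unfolding poly_sum by (intro sum.cong) auto
  with c show ?thesis by simp
qed

section \<open>Higher derivatives of Chebyshev polynomials, for (i)\<close>

text \<open>By Pascal's rule the difference is \<open>p * q + p' * q + p * q'\<close>, and
  absorption turns \<open>p'\<close> and \<open>q'\<close> into multiples of \<open>p\<close> and
  \<open>q\<close>. In the expansion below \<open>A + B\<close> does not depend on the summation
  index, so the factor on the right can be pulled out of the sum.\<close>

lemma choose_mult_choose_diff:
  fixes A B j :: nat
  shows "real (Suc j) * (real (Suc A choose Suc j) * real (Suc B choose Suc j)
            - real (A choose Suc j) * real (B choose Suc j))
       = (real A + real B + 1 - real j) * (real (A choose j) * real (B choose j))"
proof -
  define p q where "p = real (A choose j)" and "q = real (B choose j)"
  define p' q' where "p' = real (A choose Suc j)" and "q' = real (B choose Suc j)"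
  have "real m * real (m choose j) = real j * real (m choose j) + real (Suc j) * real (m choose Suc j)" for m
    using gbinomial_mult_1[of "real m" j] by (simp only: binomial_gbinomial)
  from this[of A] this[of B]
  have "real A * p = real j * p + real (Suc j) * p'" "real B * q = real j * q + real (Suc j) * q'"
    by (simp_all only: p_def q_def p'_def q'_def)
  then have "real (Suc j) * ((p + p') * (q + q') - p' * q') = (real A + real B + 1 - real j) * (p * q)"
    unfolding of_nat_Suc by algebra
  then show ?thesis
    by (simp add: p_def q_def p'_def q'_def)
qed

text \<open>Outer induction on the order \<open>j\<close>, inner induction on \<open>m\<close> in
  steps of two, both driven by \<open>higher_pderiv_cheb_U_rec\<close>. Indexing by
  \<open>m + Suc j\<close> makes \<open>m\<close> the degree of the derivative.\<close>

lemma higher_pderiv_cheb_U: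
  "(pderiv ^^ Suc j) (cheb_U (m + Suc j)) =
     smult (2 ^ Suc j * fact j)
       (\<Sum>i\<le>m div 2. smult (real ((m + Suc j - i) choose j) * real ((j + i) choose j)
            * real (m - 2 * i + 1)) (cheb_U (m - 2 * i)))"
proof -
  define a where "a j m i = real ((m + Suc j - i) choose j) * real ((j + i) choose j)
            * real (m - 2 * i + 1)" for j m i :: nat
  define T where "T j m = (\<Sum>i\<le>m div 2. smult (a j m i) (cheb_U (m - 2 * i)))" for j m
  \<comment> \<open>Splitting off \<open>i = 0\<close> leaves a sum over the same polynomials
    \<open>cheb_U (m - 2 * i)\<close> as in \<open>T j m\<close>, so coefficients can be compared
    termwise.\<close>
  have T_Suc: "smult c (T j (Suc (Suc m))) = smult (c * a j (Suc (Suc m)) 0) (cheb_U (Suc (Suc m)))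
      + (\<Sum>i\<le>m div 2. smult (c * a j (Suc (Suc m)) (Suc i)) (cheb_U (m - 2 * i)))" for c j m
    by (simp add: T_def sum.atMost_Suc_shift smult_add_right smult_sum_right del: sum.atMost_Suc)
  \<comment> \<open>Serves the base cases \<open>m = 0\<close> and \<open>m = 1\<close>: there the
    derivative on the right of \<open>step\<close> has order above the degree.\<close>
  have low: "(pderiv ^^ Suc j) (cheb_U i) = 0" if "i \<le> j" for i j
    using that degree_cheb_U_le[of i]
    by (intro poly_eqI) (simp add: coeff_higher_pderiv coeff_eq_0 del: funpow.simps)
  have "(pderiv ^^ Suc j) (cheb_U (m + Suc j)) = smult (2 ^ Suc j * fact j) (T j m)"
  proof (induction j arbitrary: m)
    case 0
    show ?case
    proof (induction m rule: induct_nat_012)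
      case (ge2 m)
      have "T 0 (Suc (Suc m)) = smult (real m + 3) (cheb_U (Suc (Suc m))) + T 0 m"
        using T_Suc[of 1 0 m] by (simp add: a_def T_def add.commute)
      with ge2 higher_pderiv_cheb_U_rec[of 0 "Suc m"] show ?case
        by (simp add: smult_add_right algebra_simps)
    qed (simp_all add: cheb_U_0 cheb_U_1 cheb_U_rec pderiv_pCons one_pCons T_def a_def)
  next
    case (Suc j)
    \<comment> \<open>The recurrence trades \<open>m\<close> for \<open>m - 2\<close> at the same
      order, plus a term of one order less, to which the outer hypothesis applies.\<close>
    have step: "(pderiv ^^ Suc (Suc j)) (cheb_U (m + Suc (Suc j))) =
      (pderiv ^^ Suc (Suc j)) (cheb_U (m + j)) +
      smult (2 * (real m + real j + 2) * (2 ^ Suc j * fact j)) (T j m)" for m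
      using higher_pderiv_cheb_U_rec[of "Suc j" "m + j"] Suc[of m]
      by (simp del: funpow.simps add: add_ac)
    show ?case
    proof (induction m rule: induct_nat_012)
      case (ge2 m)
      have a_0: "real (Suc j) * a (Suc j) (Suc (Suc m)) 0
          = (real m + real j + 4) * a j (Suc (Suc m)) 0"
        using binomial_absorption[of j "Suc (Suc m) + Suc (Suc j)", THEN arg_cong[where f = real]]
        by (simp only: a_def of_nat_mult mult.assoc[symmetric]) (simp add: add_ac)
      \<comment> \<open>Here \<open>choose_mult_choose_diff\<close> is taken at \<open>A\<close> and
        \<open>B = Suc j + i\<close>, where \<open>A + B + 1 - j\<close> collapses to
        \<open>m + j + 4\<close>, the same factor as in \<open>a_0\<close>.\<close>
      have a_Suc: "real (Suc j) * a (Suc j) (Suc (Suc m)) (Suc i)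
          = real (Suc j) * a (Suc j) m i + (real m + real j + 4) * a j (Suc (Suc m)) (Suc i)"
        if "i \<le> m div 2" for i
      proof -
        define A where "A = m + Suc (Suc j) - i"
        have A: "Suc (Suc m) + Suc (Suc j) - Suc i = Suc A" "m + Suc (Suc j) - i = A"
          "Suc (Suc m) + Suc j - Suc i = A" "real A = real m + real j + 2 - real i"
          using that by (auto simp: A_def of_nat_diff)
        have "real (Suc j) * real (Suc A choose Suc j) * real (Suc (Suc j + i) choose Suc j)
            = real (Suc j) * real (A choose Suc j) * real ((Suc j + i) choose Suc j)
              + (real m + real j + 4) * (real (A choose j) * real ((Suc j + i) choose j))"
          using choose_mult_choose_diff[of j A "Suc j + i"]
          unfolding A(4) by (simp only: right_diff_distrib) (simp add: algebra_simps)
        moreover have "Suc j + Suc i = Suc (Suc j + i)" "j + Suc i = Suc j + i"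
          "Suc (Suc m) - 2 * Suc i = m - 2 * i" by auto
        ultimately show ?thesis
          unfolding a_def A by (simp only: distrib_right mult.assoc[symmetric])
      qed
      have "smult (real (Suc j)) (T (Suc j) (Suc (Suc m))) =
        smult ((real m + real j + 4) * a j (Suc (Suc m)) 0) (cheb_U (Suc (Suc m)))
        + (\<Sum>i\<le>m div 2. smult (real (Suc j) * a (Suc j) m i
            + (real m + real j + 4) * a j (Suc (Suc m)) (Suc i)) (cheb_U (m - 2 * i)))"
        unfolding T_Suc a_0 by (intro arg_cong2[where f = "(+)"] sum.cong refl) (simp only: a_Suc atMost_iff)
      also have "\<dots> = smult (real (Suc j)) (T (Suc j) m) + smult (real m + real j + 4) (T j (Suc (Suc m)))"
        unfolding T_Suc T_def[of "Suc j" m]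
        by (simp only: smult_add_left sum.distrib smult_sum_right smult_smult add_ac)
      finally have T: "smult (2 ^ Suc (Suc j) * fact j) (smult (real (Suc j)) (T (Suc j) (Suc (Suc m)))) =
        smult (2 ^ Suc (Suc j) * fact j) (smult (real (Suc j)) (T (Suc j) m)
          + smult (real m + real j + 4) (T j (Suc (Suc m))))"
        by (rule arg_cong)
      have "Suc (Suc m) + j = m + Suc (Suc j)" by simp
      with step[of "Suc (Suc m)"] ge2(1)
      have "(pderiv ^^ Suc (Suc j)) (cheb_U (Suc (Suc m) + Suc (Suc j))) =
        smult (2 ^ Suc (Suc j) * fact (Suc j)) (T (Suc j) m) +
        smult (2 * (real (Suc (Suc m)) + real j + 2) * (2 ^ Suc j * fact j)) (T j (Suc (Suc m)))"
        by (simp only:)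
      also have "\<dots> = smult (2 ^ Suc (Suc j) * fact (Suc j)) (T (Suc j) (Suc (Suc m)))"
        using T by (simp add: smult_add_right algebra_simps)
      finally show ?case .
    next
      case 0
      show ?case
        using step[of 0] by (simp add: low T_def a_def algebra_simps del: funpow.simps)
    next
      case 1
      have "real (Suc j) * a (Suc j) 1 0 = (real j + 3) * a j 1 0"
        using binomial_absorption[of j "Suc (Suc (Suc j))", THEN arg_cong[where f = real]]
        by (simp add: a_def algebra_simps del: binomial_Suc_Suc)
      then have "2 ^ Suc (Suc j) * fact (Suc j) * a (Suc j) 1 0
          = 2 * (real 1 + real j + 2) * (2 ^ Suc j * fact j) * a j 1 0"
        by simp
      then show ?case
        using step[of 1] by (simp add: low T_def algebra_simps del: funpow.simps fact_Suc power_Suc)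
    qed
  qed
  then show ?thesis unfolding T_def a_def .
qed

section \<open>Jacobi polynomials: derivatives, and the case of parameters 1/2, for (iii)\<close>

text \<open>Termwise differentiation kills the constant term. In the others
  \<open>pochhammer_rec\<close> extracts a first factor independent of \<open>k\<close>, and the
  remaining rising factorial starts where the raised parameters require.\<close>

lemma pderiv_jacobi_poly:
  "pderiv (jacobi_poly (Suc n) \<alpha> \<beta>) =
     smult ((real n + \<alpha> + \<beta> + 2) / 2) (jacobi_poly n (\<alpha> + 1) (\<beta> + 1))"
proof -
  let ?z = "[:- 1/2, 1/2:] :: real poly"
  have dz: "pderiv (?z ^ Suc k) = smult (real (Suc k) / 2) (?z ^ k)" for k
    by (simp only: pderiv_power_Suc) (simp add: pderiv_pCons)
  have "real (Suc n) + \<alpha> = real n + (\<alpha> + 1)"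
    "real (Suc n) + \<alpha> + \<beta> + 1 = real n + \<alpha> + \<beta> + 2"
    "real n + (\<alpha> + 1) + (\<beta> + 1) + 1 = (real n + \<alpha> + \<beta> + 2) + 1"
    by simp_all
  then show ?thesis
    unfolding jacobi_poly_def sum.atMost_Suc_shift pderiv_add higher_pderiv_sum[of 1, simplified] pderiv_smult dz
      smult_sum_right smult_smult pochhammer_rec
    by (simp only:) (simp del: power_Suc of_nat_Suc, intro sum.cong refl arg_cong2[where f = smult],
         simp_all add: field_simps)
qed

text \<open>Each differentiation lowers the degree by one and raises \<alpha> + \<beta> by two, so
  the factors produced grow by one each time and build a rising factorial.\<close>

lemma higher_pderiv_jacobi_poly:
  "k \<le> n \<Longrightarrow> (pderiv ^^ k) (jacobi_poly n \<alpha> \<beta>) =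
     smult (pochhammer (real n + \<alpha> + \<beta> + 1) k / 2 ^ k)
       (jacobi_poly (n - k) (\<alpha> + real k) (\<beta> + real k))"
proof (induction k)
  case (Suc k)
  then have nk: "n - k = Suc (n - Suc k)" and "k \<le> n" by simp_all
  have "(real (n - Suc k) + (\<alpha> + real k) + (\<beta> + real k) + 2) / 2 = (real n + \<alpha> + \<beta> + 1 + real k) / 2"
    using Suc.prems by (simp add: of_nat_diff)
  moreover have "\<alpha> + real k + 1 = \<alpha> + real (Suc k)" "\<beta> + real k + 1 = \<beta> + real (Suc k)" by simp_all
  ultimately show ?case
    using Suc.IH[OF \<open>k \<le> n\<close>] pderiv_jacobi_poly[of "n - Suc k" "\<alpha> + real k" "\<beta> + real k"]
    by (simp only: nk funpow.simps o_apply pderiv_smult smult_smult pochhammer_Suc) (simp add: mult.commute)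
qed simp

lemma degree_jacobi_poly_le: "degree (jacobi_poly n \<alpha> \<beta>) \<le> n"
  unfolding jacobi_poly_def
proof (intro degree_sum_le)
  fix k assume "k \<in> {..n}"
  have "degree (smult c ([:- 1/2, 1/2:] ^ k)) \<le> k" for c :: real
    using degree_smult_le[of c "[:- 1/2, 1/2:] ^ k"] degree_power_le[of "[:- 1/2, 1/2::real:]" k] by simp
  with \<open>k \<in> {..n}\<close> show "degree (smult (((real n + \<alpha>) gchoose (n - k)) *
      pochhammer (real n + \<alpha> + \<beta> + 1) k / fact k) ([:- 1/2, 1/2:] ^ k)) \<le> n"
    by (meson atMost_iff le_trans)
qed simp

text \<open>Puts \<open>cheb_U\<close> in the basis used by \<open>jacobi_poly\<close>. With
  \<open>z = (x - 1) / 2\<close> one has \<open>2 x = 2 + 4 z\<close>, and Pascal's rule gives the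
  binomials \<open>b\<close> the recurrence that this substitution demands.\<close>

lemma cheb_U_expansion_at_1:
  "cheb_U n = (\<Sum>k\<le>n. smult (4 ^ k * real ((n + k + 1) choose (2 * k + 1))) ([:- 1/2, 1/2:] ^ k))"
proof -
  define z :: "real poly" where "z = [:- 1/2, 1/2:]"
  define b where "b n k = real ((n + k + 1) choose (2 * k + 1))" for n k :: nat
  define S where "S n N = (\<Sum>k\<le>N. smult (4 ^ k * b n k) (z ^ k))" for n N
  \<comment> \<open>The binomials vanish for \<open>k > n\<close>, so the sums for \<open>n\<close>,
    \<open>n + 1\<close> and \<open>n + 2\<close> can share one upper limit.\<close>
  have trunc: "S n N = S n n" if "n \<le> N" for n N
    unfolding S_def using that
    by (intro sum.mono_neutral_right) (auto simp: b_def binomial_eq_0 simp del: binomial_Suc_Suc)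
  have b_0: "b (Suc (Suc n)) 0 = 2 * b (Suc n) 0 - b n 0" for n
    by (simp add: b_def)
  have b_rec: "b (Suc (Suc n)) (Suc k) = 2 * b (Suc n) (Suc k) + b (Suc n) k - b n (Suc k)" for n k
    by (simp add: b_def numeral_eq_Suc)
  have y: "[:0, 2:] * p = smult 2 p + smult 4 (z * p)" for p
  proof -
    have "[:0, 2:] = [:2:] + smult 4 z" by (simp add: z_def)
    then show ?thesis by (simp only: distrib_right) simp
  qed
  have rec: "S (Suc (Suc n)) (Suc M) =
      smult 2 (S (Suc n) (Suc M)) + smult 4 (z * S (Suc n) M) - S n (Suc M)" for n M
  proof -
    have "smult 4 (z * S (Suc n) M) = (\<Sum>k\<le>M. smult (4 ^ Suc k * b (Suc n) k) (z ^ Suc k))"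
      by (simp add: S_def sum_distrib_left smult_sum_right mult.assoc)
    moreover have "smult (4 ^ Suc k * b (Suc (Suc n)) (Suc k)) p =
        smult 2 (smult (4 ^ Suc k * b (Suc n) (Suc k)) p) + smult (4 ^ Suc k * b (Suc n) k) p
        - smult (4 ^ Suc k * b n (Suc k)) p" for k p
      unfolding b_rec by (rule poly_eqI) (simp add: algebra_simps)
    ultimately show ?thesis
      unfolding S_def sum.atMost_Suc_shift smult_add_right smult_sum_right
      by (simp only: sum.distrib sum_subtractf b_0) (simp add: smult_diff_left)
  qed
  have "cheb_U n = S n n"
  proof (induction n rule: induct_nat_012)
    case (ge2 n)
    with rec[of n "Suc n"] trunc[of "Suc n" "Suc (Suc n)"] trunc[of n "Suc (Suc n)"]
    show ?case by (simp only: cheb_U_rec y)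
  qed (simp_all add: cheb_U_0 cheb_U_1 numeral_eq_Suc one_pCons S_def b_def z_def)
  then show ?thesis unfolding S_def b_def z_def .
qed

text \<open>This is the coefficient comparison behind \<open>jacobi_poly_half\<close>. From
  \<open>k\<close> to \<open>k + 1\<close> both sides change by the ratio
  \<open>(n - k) * (n + k + 2) / ((k + 3/2) * (k + 1))\<close>.\<close>

lemma gchoose_half_identity:
  assumes "k \<le> n"
  shows "(real n + 1) * (((real n + 1/2) gchoose (n - k)) * pochhammer (real n + 2) k / fact k)
     = ((real n + 1/2) gchoose n) * (4 ^ k * real ((n + k + 1) choose (2 * k + 1)))"
  using assms
proof (induction k)
  case (Suc k)
  define g g' where "g = ((real n + 1/2) gchoose (n - k))" and "g' = ((real n + 1/2) gchoose (n - Suc k))"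
  define p p' where "p = pochhammer (real n + 2) k / fact k"
    and "p' = pochhammer (real n + 2) (Suc k) / fact (Suc k)"
  define b b' where "b = real ((n + k + 1) choose (2 * k + 1))"
    and "b' = real ((n + Suc k + 1) choose (2 * Suc k + 1))"
  have nk: "n - k = Suc (n - Suc k)" using Suc.prems by simp
  have g: "g * (real n - real k) = g' * (real k + 3/2)"
    using gbinomial_mult_1[of "real n + 1/2" "n - Suc k"] Suc.prems
    unfolding g_def g'_def nk by (simp add: of_nat_diff algebra_simps)
  have p: "p' * (real k + 1) = p * (real n + 2 + real k)"
  proof -
    have "p' * real (Suc k) = p * (real n + 2 + real k)"
      by (simp add: p_def p'_def pochhammer_Suc del: of_nat_Suc)
    then show ?thesis by (simp add: add.commute)
  qed
  have b: "b' * ((2 * real k + 3) * (2 * real k + 2)) = b * ((real n + real k + 2) * (real n - real k))"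
  proof -
    \<comment> \<open>An intermediate binomial between \<open>b\<close> and \<open>b'\<close>: first
      only the lower index grows, then both indices grow and absorption applies.\<close>
    define c where "c = real ((n + k + 1) choose (2 * k + 2))"
    have "real (n + k + 1) * b = real (2 * k + 1) * b + real (2 * k + 2) * c"
      using gbinomial_mult_1[of "real (n + k + 1)" "2 * k + 1"]
      unfolding b_def c_def binomial_gbinomial by simp
    moreover have "real (2 * k + 3) * b' = real (n + k + 2) * c"
      using binomial_absorption[of "2 * k + 2" "n + k + 2", THEN arg_cong[where f = real]]
      unfolding b'_def c_def of_nat_mult by (simp add: numeral_eq_Suc del: binomial_Suc_Suc)
    ultimately show ?thesis by simp algebra
  qed
  have IH: "(real n + 1) * (g * p) = ((real n + 1/2) gchoose n) * (4 ^ k * b)"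
    using Suc by (simp add: g_def p_def b_def)
  have "(real n + 1) * (g' * p') * ((real k + 3/2) * (real k + 1))
      = (real n + 1) * (g * p) * ((real n - real k) * (real n + 2 + real k))"
    using g p by algebra
  also have "\<dots> = ((real n + 1/2) gchoose n) * (4 ^ k * (4 * b')) * ((real k + 3/2) * (real k + 1))"
  proof -
    have "b * ((real n - real k) * (real n + 2 + real k)) = 4 * b' * ((real k + 3/2) * (real k + 1))"
      using b by (simp add: field_simps)
    from arg_cong[OF this, of "(*) (((real n + 1/2) gchoose n) * 4 ^ k)"]
    show ?thesis unfolding IH by (simp only: mult.assoc)
  qed
  finally have "(real n + 1) * (g' * p') = ((real n + 1/2) gchoose n) * (4 ^ k * (4 * b'))"
    using mult_right_cancel[of "(real k + 3/2) * (real k + 1)"] by (simp add: add_nonneg_eq_0_iff)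
  then show ?case unfolding g'_def p'_def b'_def by simp
qed simp

lemma jacobi_poly_half:
  "smult (real (n + 1)) (jacobi_poly n (1/2) (1/2)) = smult ((real n + 1/2) gchoose n) (cheb_U n)"
proof -
  have "smult (real n + 1) (smult (((real n + 1/2) gchoose (n - k)) * pochhammer (real n + 1/2 + 1/2 + 1) k / fact k) z)
    = smult ((real n + 1/2) gchoose n) (smult (4 ^ k * real ((n + k + 1) choose (2 * k + 1))) z)"
    if "k \<le> n" for k z
    using gchoose_half_identity[OF that] by (simp add: add.assoc)
  then show ?thesis
    unfolding cheb_U_expansion_at_1[of n] jacobi_poly_def smult_sum_right
    by (intro sum.cong) (auto simp: add.commute)
qed

section \<open>Coefficient recurrences and the alternating sum, for (ii)\<close>

text \<open>The binomial core of the recurrence for \<open>c(n, k)\<close>, stated over the reals so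
  that negative upper arguments are covered. Pascal's rule reduces it to the four numbers
  \<open>p\<close>, \<open>q\<close>, \<open>u\<close>, \<open>v\<close>.\<close>

lemma gchoose_product_identity:
  fixes a b :: real
  assumes "a - b = real k + 1"
  shows "(real k + 2) / (real k + real j + 2) * ((a + 1) gchoose Suc (k + j)) * (b gchoose j)
      + real k / (real k + real j + 1) * (a gchoose (k + j)) * ((b + 1) gchoose Suc j)
    = (real k + 1) / (real k + real j + 1) * (a gchoose (k + j)) * (b gchoose j)
      + (real k + 1) / (real k + real j + 2) * ((a + 1) gchoose Suc (k + j)) * ((b + 1) gchoose Suc j)
      - (real k + 1) / (real k + real j + 2) * (a gchoose Suc (k + j)) * (b gchoose Suc j)"
proof -
  define p q where "p = (a gchoose (k + j))" and "q = (a gchoose Suc (k + j))"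
  define u v where "u = (b gchoose j)" and "v = (b gchoose Suc j)"
  define s where "s = real k + real j + 1"
  have q: "s * q = (a - s + 1) * p"
    using gbinomial_mult_1[of a "k + j"] by (simp add: p_def q_def s_def algebra_simps)
  have v: "(s - real k) * v = (b - (s - real k) + 1) * u"
    using gbinomial_mult_1[of b j] by (simp add: u_def v_def s_def algebra_simps)
  have pos: "s > 0" "s + 1 > 0" by (simp_all add: s_def add_nonneg_pos)
  \<comment> \<open>The left side is the difference of the two sides of the next equation, in which
    \<open>q * v\<close> cancels. By \<open>q\<close> and \<open>v\<close> it equals
    \<open>(a - b - k - 1) * p * u\<close>.\<close>
  have "- (p * u) + s * q * u - (s - real k) * v * p = 0"
    unfolding q v using assms by algebra
  then have "(real k + 2) * s * ((p + q) * u) + real k * (s + 1) * (p * (u + v))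
      = (real k + 1) * (s + 1) * (p * u) + (real k + 1) * s * ((p + q) * (u + v))
        - (real k + 1) * s * (q * v)"
    by (simp add: algebra_simps)
  then have "((real k + 2) * s * ((p + q) * u) + real k * (s + 1) * (p * (u + v))) / (s * (s + 1))
      = ((real k + 1) * (s + 1) * (p * u) + (real k + 1) * s * ((p + q) * (u + v))
        - (real k + 1) * s * (q * v)) / (s * (s + 1))"
    by (rule arg_cong)
  then have "(real k + 2) * ((p + q) * u) / (s + 1) + real k * (p * (u + v)) / s
      = (real k + 1) * (p * u) / s + (real k + 1) * ((p + q) * (u + v)) / (s + 1)
        - (real k + 1) * (q * v) / (s + 1)"
    using pos by (simp add: add_divide_distrib diff_divide_distrib)
  then have "(real k + 2) / (s + 1) * (p + q) * u + real k / s * p * (u + v)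
      = (real k + 1) / s * p * u + (real k + 1) / (s + 1) * (p + q) * (u + v)
        - (real k + 1) / (s + 1) * q * v"
    by (simp add: mult.assoc)
  moreover have "s + 1 = real k + real j + 2" by (simp add: s_def)
  ultimately show ?thesis
    unfolding p_def q_def u_def v_def s_def by (simp only: gbinomial_Suc_Suc)
qed

text \<open>
  The \<open>rev_coeff\<close> vanish for \<open>n < k + 2 * i\<close>, and \<open>rev_term\<close> guards this range explicitly because the
  exponent \<open>n - (k + 2 * i)\<close> would be truncated there.
\<close>

definition rev_coeff :: "nat \<Rightarrow> nat \<Rightarrow> nat \<Rightarrow> real" where
  "rev_coeff n k i = (real (k + 1) / real (i + k + 1)) * real ((n - i) choose (k + i))
     * ((real n - real k - real i - 1) gchoose i)"

lemma rev_coeff_eq_0: "n < k + 2 * i \<Longrightarrow> rev_coeff n k i = 0"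
  unfolding rev_coeff_def by (subst binomial_eq_0) auto

lemma rev_coeff_0: "rev_coeff n k 0 = real (n choose k)"
  by (simp add: rev_coeff_def)

text \<open>This is \<open>gchoose_product_identity\<close> at \<open>a = n - j\<close> and
  \<open>b = n - k - j - 1\<close>; the assumption makes the natural-number subtractions
  exact.\<close>

lemma rev_coeff_rec:
  assumes "k + 2 * j \<le> n"
  shows "rev_coeff (Suc n) (Suc k) j + (if k = 0 then 0 else rev_coeff (Suc n) (k - 1) (Suc j))
    = rev_coeff n k j + rev_coeff (Suc (Suc n)) k (Suc j) - rev_coeff (Suc n) k (Suc j)"
proof -
  define a b where "a = real n - real j" and "b = real n - real k - real j - 1"
  have a: "real (n - j) = a" "real (Suc n - j) = a + 1"
    using assms by (auto simp: a_def of_nat_diff)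
  have "(if k = 0 then 0 else rev_coeff (Suc n) (k - 1) (Suc j))
      = real k / (real k + real j + 1) * (a gchoose (k + j)) * ((b + 1) gchoose Suc j)"
  proof (cases k)
    case (Suc l)
    have "real (Suc n) - real l - real (Suc j) - 1 = b + 1" by (simp add: Suc b_def)
    then show ?thesis
      by (simp add: Suc rev_coeff_def binomial_gbinomial a algebra_simps)
  qed simp
  moreover have "real (Suc n) - real (Suc k) - real j - 1 = b"
     "real (Suc (Suc n)) - real k - real (Suc j) - 1 = b + 1"
     "real (Suc n) - real k - real (Suc j) - 1 = b"
    by (simp_all add: b_def)
  moreover have "real (j + Suc k + 1) = real k + real j + 2" "real (Suc j + k + 1) = real k + real j + 2"
    "real (j + k + 1) = real k + real j + 1" "real (Suc k + 1) = real k + 2" "real (k + 1) = real k + 1"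
    by simp_all
  moreover have "Suc n - Suc j = n - j" "Suc (Suc n) - Suc j = Suc n - j" by simp_all
  ultimately show ?thesis
    using gchoose_product_identity[of a b k j]
    by (simp only: rev_coeff_def binomial_gbinomial a add_Suc add_Suc_right b_def[symmetric])
       (simp add: a_def b_def)
qed

definition rev_term :: "real poly \<Rightarrow> nat \<Rightarrow> nat \<Rightarrow> nat \<Rightarrow> real poly" where
  "rev_term y n k i = (if k + 2 * i \<le> n
     then smult ((-1) ^ (n - (k + 2 * i)) * rev_coeff n k i) (y ^ (n - (k + 2 * i))) else 0)"

text \<open>The coefficient \<open>c(n, k)\<close>. Thanks to the guard in \<open>rev_term\<close>
  the summation bound need not depend on \<open>k\<close>, which eases comparing neighbouring
  \<open>k\<close>.\<close>

definition rev_poly :: "real poly \<Rightarrow> nat \<Rightarrow> nat \<Rightarrow> real poly" where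
  "rev_poly y n k = (\<Sum>i\<le>n. rev_term y n k i)"

text \<open>All five summands carry the power \<open>y ^ e\<close> with
  \<open>e = n - (k + 2 * j)\<close>. The last one has a sign of opposite parity, which accounts for
  the minus in \<open>rev_coeff_rec\<close>.\<close>

lemma rev_term_Suc_rec:
  "rev_term y (Suc n) (Suc k) j + (if k = 0 then 0 else rev_term y (Suc n) (k - 1) (Suc j))
    = rev_term y n k j + rev_term y (Suc (Suc n)) k (Suc j) + y * rev_term y (Suc n) k (Suc j)"
proof (cases "k + 2 * j \<le> n")
  case True
  define e where "e = n - (k + 2 * j)"
  have n: "n = k + 2 * j + e" using True by (simp add: e_def)
  have "y * rev_term y (Suc n) k (Suc j) = smult (- ((-1) ^ e * rev_coeff (Suc n) k (Suc j))) (y ^ e)"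
  proof (cases e)
    \<comment> \<open>For \<open>e = 0\<close> the term on the left fails the guard, while the
      coefficient on the right vanishes because \<open>Suc n < k + 2 * Suc j\<close>.\<close>
    case 0
    then show ?thesis by (simp add: rev_term_def n rev_coeff_eq_0)
  next
    case (Suc d)
    then have "Suc n - (k + 2 * Suc j) = d" "k + 2 * Suc j \<le> Suc n" by (simp_all add: n)
    then show ?thesis by (simp add: rev_term_def Suc)
  qed
  moreover have "rev_term y (Suc n) (Suc k) j = smult ((-1) ^ e * rev_coeff (Suc n) (Suc k) j) (y ^ e)"
    "rev_term y n k j = smult ((-1) ^ e * rev_coeff n k j) (y ^ e)"
    "rev_term y (Suc (Suc n)) k (Suc j) = smult ((-1) ^ e * rev_coeff (Suc (Suc n)) k (Suc j)) (y ^ e)"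
    by (simp_all add: rev_term_def n)
  moreover have "(if k = 0 then 0 else rev_term y (Suc n) (k - 1) (Suc j)) =
      smult ((-1) ^ e * (if k = 0 then 0 else rev_coeff (Suc n) (k - 1) (Suc j))) (y ^ e)"
    by (cases k) (simp_all add: rev_term_def n)
  ultimately show ?thesis
    using rev_coeff_rec[OF True]
    by (simp only: smult_add_left[symmetric] distrib_left[symmetric] mult_minus_right[symmetric])
       simp
next
  case False
  then show ?thesis by (auto simp: rev_term_def)
qed

text \<open>The boundary case \<open>j = -1\<close> of \<open>rev_term_Suc_rec\<close>, where the
  two terms with index \<open>j\<close> are absent. For \<open>k > 0\<close> it comes down to
  Pascal's rule.\<close>

lemma rev_term_0_rec:
  "(if k = 0 then 0 else rev_term y (Suc n) (k - 1) 0)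
    = rev_term y (Suc (Suc n)) k 0 + y * rev_term y (Suc n) k 0"
proof (cases k)
  case 0
  then show ?thesis by (simp add: rev_term_def rev_coeff_0)
next
  case (Suc l)
  consider "l \<le> n" | "l = Suc n" | "l > Suc n" by linarith
  then show ?thesis
  proof cases
    case 1
    then have "Suc n - l = Suc (n - l)" by simp
    with 1 show ?thesis
      by (simp add: Suc rev_term_def rev_coeff_0 algebra_simps flip: smult_minus_left smult_add_left)
  qed (simp_all add: Suc rev_term_def rev_coeff_0)
qed

lemma rev_poly_eq_sum:
  assumes "n \<le> N"
  shows "rev_poly y n k = (\<Sum>i\<le>N. rev_term y n k i)"
  unfolding rev_poly_def using assms
  by (intro sum.mono_neutral_left) (auto simp: rev_term_def)

lemma rev_poly_eq_0: "n < k \<Longrightarrow> rev_poly y n k = 0"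
  by (simp add: rev_poly_def rev_term_def)

lemma rev_poly_rec:
  "rev_poly y (Suc n) (Suc k) + (if k = 0 then 0 else rev_poly y (Suc n) (k - 1))
    = rev_poly y n k + rev_poly y (Suc (Suc n)) k + y * rev_poly y (Suc n) k"
proof -
  define M where "M = Suc n"
  \<comment> \<open>Polynomials entering the term recurrence at index \<open>j\<close> are expanded
    by \<open>low\<close>, those entering at \<open>Suc j\<close> by \<open>split\<close>; the
    common bound \<open>M\<close> allows termwise addition.\<close>
  have low: "rev_poly y m l = (\<Sum>i\<le>M. rev_term y m l i)" if "m \<le> Suc n" for m l
    using that by (intro rev_poly_eq_sum) (simp add: M_def)
  have split: "rev_poly y m l = rev_term y m l 0 + (\<Sum>i\<le>M. rev_term y m l (Suc i))"
    if "m \<le> Suc (Suc n)" for m l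
    using that rev_poly_eq_sum[of m "Suc M"] by (simp add: M_def sum.atMost_Suc_shift del: sum.atMost_Suc)
  have "(if k = 0 then 0 else rev_poly y (Suc n) (k - 1)) =
      (if k = 0 then 0 else rev_term y (Suc n) (k - 1) 0)
      + (\<Sum>i\<le>M. if k = 0 then 0 else rev_term y (Suc n) (k - 1) (Suc i))"
    by (simp add: split)
  then have "rev_poly y (Suc n) (Suc k) + (if k = 0 then 0 else rev_poly y (Suc n) (k - 1)) =
      (if k = 0 then 0 else rev_term y (Suc n) (k - 1) 0) +
      (\<Sum>i\<le>M. rev_term y (Suc n) (Suc k) i + (if k = 0 then 0 else rev_term y (Suc n) (k - 1) (Suc i)))"
    by (simp only: low order_refl sum.distrib add_ac)
  also have "\<dots> = (rev_term y (Suc (Suc n)) k 0 + y * rev_term y (Suc n) k 0)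
      + (\<Sum>i\<le>M. rev_term y n k i + rev_term y (Suc (Suc n)) k (Suc i) + y * rev_term y (Suc n) k (Suc i))"
    by (simp only: rev_term_0_rec rev_term_Suc_rec)
  also have "\<dots> = rev_poly y n k + rev_poly y (Suc (Suc n)) k + y * rev_poly y (Suc n) k"
    using low[of n k] split[of "Suc (Suc n)" k] split[of "Suc n" k]
    by (simp add: sum.distrib sum_distrib_left distrib_left)
  finally show ?thesis .
qed

lemma sum_rev_poly_cheb_U:
  "(\<Sum>k\<le>n. rev_poly (cheb_U 1) n k * cheb_U k) = [:cos (pi * real n / 2):]"
proof (induction n rule: induct_nat_012)
  case 0
  show ?case by (simp add: rev_poly_def rev_term_def rev_coeff_0 cheb_U_0 one_pCons)
next
  case 1
  show ?case
    by (simp add: rev_poly_def rev_term_def rev_coeff_0 cheb_U_0 cheb_U_1 rev_coeff_eq_0)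
next
  case (ge2 n)
  define y where "y = cheb_U 1"
  define c where "c = rev_poly y"
  have ext: "(\<Sum>k\<le>m. c m k * cheb_U k) = (\<Sum>k\<le>N. c m k * cheb_U k)" if "m \<le> N" for m N
    using that by (intro sum.mono_neutral_left) (auto simp: c_def rev_poly_eq_0)
  have y_0: "y * cheb_U 0 = cheb_U (Suc 0)"
    by (simp add: y_def cheb_U_0)
  have y_Suc: "y * cheb_U (Suc k) = cheb_U (Suc (Suc k)) + cheb_U k" for k
    by (simp add: y_def cheb_U_rec cheb_U_1)
  \<comment> \<open>Moving \<open>y\<close> onto \<open>cheb_U k\<close> and shifting indices brings
    in the left side of \<open>rev_poly_rec\<close>. Its right side reproduces \<open>y\<close>
    times the same sum, which cancels.\<close>
  have "y * (\<Sum>k\<le>Suc n. c (Suc n) k * cheb_U k) = (\<Sum>k\<le>Suc n. c (Suc n) k * (y * cheb_U k))"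
    by (simp add: sum_distrib_left mult.left_commute del: sum.atMost_Suc)
  also have "\<dots> = (\<Sum>k\<le>Suc n. c (Suc n) k * cheb_U (Suc k)) + (\<Sum>k\<le>n. c (Suc n) (Suc k) * cheb_U k)"
    unfolding sum.atMost_Suc_shift y_0 y_Suc by (simp add: sum.distrib distrib_left)
  also have "(\<Sum>k\<le>n. c (Suc n) (Suc k) * cheb_U k) = (\<Sum>k\<le>Suc (Suc n). c (Suc n) (Suc k) * cheb_U k)"
    by (simp add: c_def rev_poly_eq_0)
  also have "(\<Sum>k\<le>Suc n. c (Suc n) k * cheb_U (Suc k))
      = (\<Sum>k\<le>Suc (Suc n). (if k = 0 then 0 else c (Suc n) (k - 1)) * cheb_U k)"
    by (simp add: sum.atMost_Suc_shift del: sum.atMost_Suc)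
  also have "\<dots> + (\<Sum>k\<le>Suc (Suc n). c (Suc n) (Suc k) * cheb_U k)
      = (\<Sum>k\<le>Suc (Suc n). (c n k + c (Suc (Suc n)) k + y * c (Suc n) k) * cheb_U k)"
    unfolding c_def rev_poly_rec[symmetric] by (simp only: sum.distrib distrib_right add.commute)
  also have "\<dots> = (\<Sum>k\<le>n. c n k * cheb_U k) + (\<Sum>k\<le>Suc (Suc n). c (Suc (Suc n)) k * cheb_U k)
      + y * (\<Sum>k\<le>Suc n. c (Suc n) k * cheb_U k)"
    using ext[of n "Suc (Suc n)"] ext[of "Suc n" "Suc (Suc n)"]
    by (simp only: sum.distrib distrib_right sum_distrib_left mult.assoc)
  finally have "(\<Sum>k\<le>Suc (Suc n). c (Suc (Suc n)) k * cheb_U k) = - (\<Sum>k\<le>n. c n k * cheb_U k)"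
    by (simp add: eq_neg_iff_add_eq_0 add.commute del: sum.atMost_Suc)
  then show ?case
    using ge2(1) unfolding c_def y_def cos_half_pi_Suc_Suc by (simp del: sum.atMost_Suc)
qed

section \<open>Assembly of the three identities\<close>

theorem theorem3:
  fixes n :: nat
  assumes "n \<ge> 1"
  shows
    "(cheb_U n
        + (\<Sum>k = 1..n. smult (1 / real k) ((- cheb_U 1) ^ k) *
             (\<Sum>i = 0..(n - k) div 2.
                smult (real ((n - i) choose (k - 1)) * real ((k + i - 1) choose (k - 1))
                         * real (n - k - 2 * i + 1))
                  (cheb_U (n - k - 2 * i))))
      = [:cos (pi * real n / 2):])
     \<and>
     ((\<Sum>k = 0..n.
         (\<Sum>i = 0..(n - k) div 2.
            smult ((-1) ^ (n - (k + 2 * i)) * (real (k + 1) / real (i + k + 1))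
                     * real ((n - i) choose (k + i))
                     * ((real n - real k - real i - 1) gchoose i))
              (cheb_U 1 ^ (n - (k + 2 * i))))
         * cheb_U k)
      = [:cos (pi * real n / 2):])
     \<and>
     (smult (real (n + 1)) (jacobi_poly n (1/2) (1/2))
        + (\<Sum>k = 1..n.
             smult (fact (n + k + 1) / (fact k * 2 ^ k * fact n)) ((- [:0, 1:]) ^ k)
               * jacobi_poly (n - k) (real k + 1/2) (real k + 1/2))
      = [:((real n + 1/2) gchoose n) * cos (pi * real n / 2):])"
proof (intro conjI)
  let ?x = "[:0, 1::real:]"
  have "smult (1 / real k) ((- cheb_U 1) ^ k) *
      (\<Sum>i = 0..(n - k) div 2.
        smult (real ((n - i) choose (k - 1)) * real ((k + i - 1) choose (k - 1)) * real (n - k - 2 * i + 1))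
          (cheb_U (n - k - 2 * i)))
    = smult (1 / fact k) ((- ?x) ^ k * (pderiv ^^ k) (cheb_U n))" if k: "k \<in> {1..n}" for k
  proof -
    obtain j where j: "k = Suc j" using k by (cases k) auto
    define m where "m = n - k"
    have n: "n = m + Suc j" using k by (simp add: m_def j)
    \<comment> \<open>The factor \<open>2 ^ k\<close> from the derivative formula is absorbed into
      the power of \<open>- cheb_U 1\<close>, and \<open>fact j / fact k\<close> leaves
      \<open>1 / k\<close>.\<close>
    have "- cheb_U 1 = smult 2 (- ?x)" by (simp add: cheb_U_1)
    then have U: "(- cheb_U 1) ^ k = smult (2 ^ k) ((- ?x) ^ k)" by (simp only: smult_power)
    have "1 / fact k * (2 ^ k * fact j) = (1 / real k * 2 ^ k :: real)"
      by (simp add: j divide_simps del: of_nat_Suc)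
    moreover have "n - k = m" "k - 1 = j" "k + i - 1 = j + i" for i by (simp_all add: n j)
    ultimately show ?thesis
      unfolding U atLeast0AtMost
      using higher_pderiv_cheb_U[of j m]
      by (simp only: n[symmetric, folded j] j[symmetric] mult_smult_right mult_smult_left smult_smult)
  qed
  then have "cheb_U n + (\<Sum>k = 1..n. smult (1 / real k) ((- cheb_U 1) ^ k) *
      (\<Sum>i = 0..(n - k) div 2.
        smult (real ((n - i) choose (k - 1)) * real ((k + i - 1) choose (k - 1)) * real (n - k - 2 * i + 1))
          (cheb_U (n - k - 2 * i))))
    = (\<Sum>k\<le>n. smult (1 / fact k) ((- ?x) ^ k * (pderiv ^^ k) (cheb_U n)))"
    by (simp add: atMost_atLeast0 sum.atLeast_Suc_atMost)
  also have "\<dots> = [:cos (pi * real n / 2):]"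
    by (simp only: Taylor_at_zero degree_cheb_U_le poly_cheb_U_zero)
  finally show "cheb_U n + (\<Sum>k = 1..n. smult (1 / real k) ((- cheb_U 1) ^ k) *
      (\<Sum>i = 0..(n - k) div 2.
        smult (real ((n - i) choose (k - 1)) * real ((k + i - 1) choose (k - 1)) * real (n - k - 2 * i + 1))
          (cheb_U (n - k - 2 * i)))) = [:cos (pi * real n / 2):]" .
next
  have "(\<Sum>i = 0..(n - k) div 2.
      smult ((-1) ^ (n - (k + 2 * i)) * (real (k + 1) / real (i + k + 1)) * real ((n - i) choose (k + i))
          * ((real n - real k - real i - 1) gchoose i)) (cheb_U 1 ^ (n - (k + 2 * i))))
    = rev_poly (cheb_U 1) n k" if k: "k \<in> {0..n}" for k
  proof -
    \<comment> \<open>Beyond \<open>(n - k) div 2\<close> the guard in \<open>rev_term\<close>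
      fails, so the sum shrinks to the stated range.\<close>
    have "rev_poly (cheb_U 1) n k = (\<Sum>i = 0..(n - k) div 2. rev_term (cheb_U 1) n k i)"
      unfolding rev_poly_def
      by (intro sum.mono_neutral_right) (auto simp: rev_term_def)
    also have "\<dots> = (\<Sum>i = 0..(n - k) div 2.
      smult ((-1) ^ (n - (k + 2 * i)) * (real (k + 1) / real (i + k + 1)) * real ((n - i) choose (k + i))
          * ((real n - real k - real i - 1) gchoose i)) (cheb_U 1 ^ (n - (k + 2 * i))))"
      using k by (intro sum.cong) (auto simp: rev_term_def rev_coeff_def mult.assoc)
    finally show ?thesis ..
  qed
  then show "(\<Sum>k = 0..n. (\<Sum>i = 0..(n - k) div 2.
      smult ((-1) ^ (n - (k + 2 * i)) * (real (k + 1) / real (i + k + 1)) * real ((n - i) choose (k + i))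
          * ((real n - real k - real i - 1) gchoose i)) (cheb_U 1 ^ (n - (k + 2 * i)))) * cheb_U k)
    = [:cos (pi * real n / 2):]"
    using sum_rev_poly_cheb_U[of n] by (simp add: atMost_atLeast0)
next
  let ?x = "[:0, 1::real:]"
  let ?J = "jacobi_poly n (1/2) (1/2)"
  have "smult (fact (n + k + 1) / (fact k * 2 ^ k * fact n)) ((- ?x) ^ k)
        * jacobi_poly (n - k) (real k + 1/2) (real k + 1/2)
      = smult (real (n + 1)) (smult (1 / fact k) ((- ?x) ^ k * (pderiv ^^ k) ?J))"
    if "k \<in> {1..n}" for k
  proof -
    \<comment> \<open>Matches the factorials with the rising factorial from
      \<open>higher_pderiv_jacobi_poly\<close> at parameters 1/2; the leftover
      \<open>fact (n + 1) / fact n\<close> is the overall factor \<open>n + 1\<close>.\<close>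
    have "fact (n + k + 1) = (fact (n + 1) * pochhammer (real n + 2) k :: real)"
      using pochhammer_product'[of "1 :: real" "n + 1" k]
      by (simp add: pochhammer_fact add_ac)
    then have "fact (n + k + 1) / (fact k * 2 ^ k * fact n)
        = real (n + 1) * (1 / fact k) * (pochhammer (real n + 2) k / 2 ^ k)"
      by simp
    moreover have "real n + 1/2 + 1/2 + 1 = real n + 2" by simp
    ultimately show ?thesis
      using higher_pderiv_jacobi_poly[of k n "1/2" "1/2"] that
      by (simp only: atLeastAtMost_iff mult_smult_right mult_smult_left smult_smult mult.assoc add.commute[of "1/2"])
  qed
  then have "smult (real (n + 1)) ?J + (\<Sum>k = 1..n.
      smult (fact (n + k + 1) / (fact k * 2 ^ k * fact n)) ((- ?x) ^ k)
        * jacobi_poly (n - k) (real k + 1/2) (real k + 1/2))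
    = smult (real (n + 1)) (\<Sum>k\<le>n. smult (1 / fact k) ((- ?x) ^ k * (pderiv ^^ k) ?J))"
    by (simp add: atMost_atLeast0 sum.atLeast_Suc_atMost smult_add_right smult_sum_right)
  also have "\<dots> = [:poly (smult (real (n + 1)) ?J) 0:]"
    by (simp only: Taylor_at_zero degree_jacobi_poly_le) simp
  also have "\<dots> = [:((real n + 1/2) gchoose n) * cos (pi * real n / 2):]"
    unfolding jacobi_poly_half by (simp add: poly_cheb_U_zero)
  finally show "smult (real (n + 1)) ?J + (\<Sum>k = 1..n.
      smult (fact (n + k + 1) / (fact k * 2 ^ k * fact n)) ((- ?x) ^ k)
        * jacobi_poly (n - k) (real k + 1/2) (real k + 1/2))
    = [:((real n + 1/2) gchoose n) * cos (pi * real n / 2):]" .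
qed

end
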